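(* Let $q$ be a prime positive integer. The following statements hold true: (i) the algebra $\mathbb{H}_{\mathbb{Q}}(-3,q)$ is a split algebra if and only if $q\equiv 1\pmod 3$ or $q=3$; (ii) the algebra $\mathbb{H}_{\mathbb{Q}}(-5,q)$ is a split algebra if and only if $q\equiv 1,9 \pmod{20}$ or $q=5$; (iii) the algebra $\mathbb{H}_{\mathbb{Q}}(-7,q)$ is a split algebra if and only if $q\equiv 1,2,4\pmod 7$ or $q=7$; (iv) the algebra $\mathbb{H}_{\mathbb{Q}}(-13,q)$ is a split algebra if and only if $q\equiv 1,9,17,25,29,49 \pmod{52}$.
   Context: For a field $K$ with $\operatorname{char} K\neq 2$ and nonzero $\alpha,\beta\in K$, $\mathbb{H}_{K}(\alpha,\beta)$ denotes the generalized quaternion algebra over $K$ with basis $\{1,e_1,e_2,e_3\}$ and multiplication determined by $e_1^2=\alpha$, $e_2^2=\beta$, $e_1e_2=e_3=-e_2e_1$ (so $e_3^2=-\alpha\beta$). It is called split if it is isomorphic to a matrix algebra over $K$, i.e. to $M_2(K)$. A notation such as $q\equiv a,b,c \pmod m$ means that $q$ is congruent modulo $m$ to one of the listed residues.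
   Formalization: In part (iv) the alternative "or q = 13" is added to the condition, because the algebra H_Q(-13,13) is split (13 = 0² + 13·1²) although 13 is not congruent to any listed residue modulo 52. *)

theory Defs
  imports
    "HOL-Analysis.Analysis"
    "HOL-Algebra.Module"
    "HOL-Algebra.QuotRing"
    "HOL-Computational_Algebra.Primes"
begin

text \<open>
  \<open>Quat a0 a1 a2 a3\<close> stands for \<open>a0 * 1 + a1 * e1 + a2 * e2 + a3 * e3\<close>.
\<close>

datatype 'k quat = Quat 'k 'k 'k 'k

fun quat_add :: "'k::field quat \<Rightarrow> 'k quat \<Rightarrow> 'k quat" where
  "quat_add (Quat a0 a1 a2 a3) (Quat b0 b1 b2 b3) =
    Quat (a0 + b0) (a1 + b1) (a2 + b2) (a3 + b3)"

fun quat_scale :: "'k::field \<Rightarrow> 'k quat \<Rightarrow> 'k quat" where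
  "quat_scale c (Quat a0 a1 a2 a3) = Quat (c * a0) (c * a1) (c * a2) (c * a3)"

text \<open>
  The bilinear extension of \<open>e1 * e1 = \<alpha>\<close>, \<open>e2 * e2 = \<beta>\<close>, \<open>e1 * e2 = e3 = - e2 * e1\<close>.
  By associativity, these relations also give \<open>e3 * e3 = - \<alpha> * \<beta>\<close>,
  \<open>e1 * e3 = \<alpha> * e2 = - e3 * e1\<close> and \<open>e3 * e2 = \<beta> * e1 = - e2 * e3\<close>.
\<close>

fun quat_mult :: "'k::field \<Rightarrow> 'k \<Rightarrow> 'k quat \<Rightarrow> 'k quat \<Rightarrow> 'k quat" where
  "quat_mult \<alpha> \<beta> (Quat a0 a1 a2 a3) (Quat b0 b1 b2 b3) =
    Quat (a0 * b0 + \<alpha> * a1 * b1 + \<beta> * a2 * b2 - \<alpha> * \<beta> * a3 * b3)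
         (a0 * b1 + a1 * b0 - \<beta> * a2 * b3 + \<beta> * a3 * b2)
         (a0 * b2 + a2 * b0 + \<alpha> * a1 * b3 - \<alpha> * a3 * b1)
         (a0 * b3 + a3 * b0 + a1 * b2 - a2 * b1)"

text \<open>
  Algebras over the field \<open>'k\<close> are represented by the record \<^typ>\<open>('k, 'a) module\<close>, which has
  both a ring multiplication and a scalar multiplication. The quaternion algebra is meant for
  characteristic different from 2 and nonzero \<open>\<alpha>\<close>, \<open>\<beta>\<close>.
\<close>

definition quaternion_algebra :: "'k::field \<Rightarrow> 'k \<Rightarrow> ('k, 'k quat) module"
  where "quaternion_algebra \<alpha> \<beta> =
    \<lparr>carrier = UNIV, mult = quat_mult \<alpha> \<beta>, one = Quat 1 0 0 0,
     zero = Quat 0 0 0 0, add = quat_add, smult = quat_scale\<rparr>"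

definition matrix_algebra2 :: "('k::field, 'k ^ 2 ^ 2) module"
  where "matrix_algebra2 =
    \<lparr>carrier = UNIV, mult = (**), one = mat 1,
     zero = 0, add = (+), smult = (\<lambda>c. map_matrix ((*) c))\<rparr>"

definition algebra_iso :: "('k, 'a) module \<Rightarrow> ('k, 'b) module \<Rightarrow> ('a \<Rightarrow> 'b) set"
  where "algebra_iso A B =
    {h \<in> ring_iso A B. \<forall>c. \<forall>x\<in>carrier A. h (c \<odot>\<^bsub>A\<^esub> x) = c \<odot>\<^bsub>B\<^esub> h x}"

definition split_algebra :: "('k::field, 'a) module \<Rightarrow> bool"
  where "split_algebra A \<longleftrightarrow> algebra_iso A (matrix_algebra2 :: ('k, 'k ^ 2 ^ 2) module) \<noteq> {}"

lemma quaternion_relations: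
  fixes \<alpha> \<beta> :: "'k::field"
  defines "e1 \<equiv> Quat 0 1 0 0" and "e2 \<equiv> Quat 0 0 1 0" and "e3 \<equiv> Quat 0 0 0 1"
  shows "quat_mult \<alpha> \<beta> e1 e1 = quat_scale \<alpha> (Quat 1 0 0 0)"
    and "quat_mult \<alpha> \<beta> e2 e2 = quat_scale \<beta> (Quat 1 0 0 0)"
    and "quat_mult \<alpha> \<beta> e1 e2 = e3"
    and "quat_mult \<alpha> \<beta> e2 e1 = quat_scale (- 1) e3"
    and "quat_mult \<alpha> \<beta> e3 e3 = quat_scale (- (\<alpha> * \<beta>)) (Quat 1 0 0 0)"
  by (simp_all add: e1_def e2_def e3_def)

lemma ring_quaternion_algebra: "ring (quaternion_algebra \<alpha> \<beta>)"
proof (rule ringI)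
  show "abelian_group (quaternion_algebra \<alpha> \<beta>)"
  proof (rule abelian_groupI)
    fix x assume "x \<in> carrier (quaternion_algebra \<alpha> \<beta>)"
    show "\<exists>y\<in>carrier (quaternion_algebra \<alpha> \<beta>).
        y \<oplus>\<^bsub>quaternion_algebra \<alpha> \<beta>\<^esub> x = \<zero>\<^bsub>quaternion_algebra \<alpha> \<beta>\<^esub>"
      by (cases x, rule bexI[of _ "quat_scale (- 1) x"]) (simp_all add: quaternion_algebra_def)
  next
    fix x y z :: "'a quat"
    show "x \<oplus>\<^bsub>quaternion_algebra \<alpha> \<beta>\<^esub> y \<oplus>\<^bsub>quaternion_algebra \<alpha> \<beta>\<^esub> z =
        x \<oplus>\<^bsub>quaternion_algebra \<alpha> \<beta>\<^esub> (y \<oplus>\<^bsub>quaternion_algebra \<alpha> \<beta>\<^esub> z)"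
      by (cases x; cases y; cases z) (simp add: quaternion_algebra_def)
    show "x \<oplus>\<^bsub>quaternion_algebra \<alpha> \<beta>\<^esub> y = y \<oplus>\<^bsub>quaternion_algebra \<alpha> \<beta>\<^esub> x"
      by (cases x; cases y) (simp add: quaternion_algebra_def)
    show "\<zero>\<^bsub>quaternion_algebra \<alpha> \<beta>\<^esub> \<oplus>\<^bsub>quaternion_algebra \<alpha> \<beta>\<^esub> x = x"
      by (cases x) (simp add: quaternion_algebra_def)
  qed (simp_all add: quaternion_algebra_def)
next
  show "monoid (quaternion_algebra \<alpha> \<beta>)"
  proof (rule monoidI)
    fix x y z :: "'a quat"
    show "x \<otimes>\<^bsub>quaternion_algebra \<alpha> \<beta>\<^esub> y \<otimes>\<^bsub>quaternion_algebra \<alpha> \<beta>\<^esub> z =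
        x \<otimes>\<^bsub>quaternion_algebra \<alpha> \<beta>\<^esub> (y \<otimes>\<^bsub>quaternion_algebra \<alpha> \<beta>\<^esub> z)"
      by (cases x; cases y; cases z) (simp add: quaternion_algebra_def algebra_simps)
    show "\<one>\<^bsub>quaternion_algebra \<alpha> \<beta>\<^esub> \<otimes>\<^bsub>quaternion_algebra \<alpha> \<beta>\<^esub> x = x"
      and "x \<otimes>\<^bsub>quaternion_algebra \<alpha> \<beta>\<^esub> \<one>\<^bsub>quaternion_algebra \<alpha> \<beta>\<^esub> = x"
      by (cases x; simp add: quaternion_algebra_def)+
  qed (simp_all add: quaternion_algebra_def)
next
  fix x y z :: "'a quat"
  show "(x \<oplus>\<^bsub>quaternion_algebra \<alpha> \<beta>\<^esub> y) \<otimes>\<^bsub>quaternion_algebra \<alpha> \<beta>\<^esub> z =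
      x \<otimes>\<^bsub>quaternion_algebra \<alpha> \<beta>\<^esub> z \<oplus>\<^bsub>quaternion_algebra \<alpha> \<beta>\<^esub> y \<otimes>\<^bsub>quaternion_algebra \<alpha> \<beta>\<^esub> z"
    and "z \<otimes>\<^bsub>quaternion_algebra \<alpha> \<beta>\<^esub> (x \<oplus>\<^bsub>quaternion_algebra \<alpha> \<beta>\<^esub> y) =
      z \<otimes>\<^bsub>quaternion_algebra \<alpha> \<beta>\<^esub> x \<oplus>\<^bsub>quaternion_algebra \<alpha> \<beta>\<^esub> z \<otimes>\<^bsub>quaternion_algebra \<alpha> \<beta>\<^esub> y"
    by (cases x; cases y; cases z; simp add: quaternion_algebra_def algebra_simps)+
qed

end

theory Submission
  imports Defs "HOL-Number_Theory.Quadratic_Reciprocity"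
begin

text \<open>
  The algebra splits iff \<open>q = a\<^sup>2 + p * b\<^sup>2\<close> has a rational solution: a solution gives explicit matrices
  for \<open>e1\<close> and \<open>e2\<close>, and conversely a nonzero element of square zero, which every matrix algebra
  has, yields one. A primitive integer solution of \<open>x\<^sup>2 + p * y\<^sup>2 = q * z\<^sup>2\<close>, read modulo \<open>p\<close> and
  modulo 4, gives the necessary congruences. For sufficiency, reciprocity makes \<open>- p\<close> a square
  modulo \<open>q\<close>, so by Thue's lemma some \<open>k * q\<close> with \<open>1 \<le> k \<le> p\<close> is of the form \<open>x\<^sup>2 + p * y\<^sup>2\<close>;
  congruences modulo \<open>p\<close> (and modulo 16 for \<open>p = 13\<close>) leave only those \<open>k\<close> that are themselves
  norms, and \<open>q\<close> is a quotient of norms.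
\<close>

subsection \<open>Split quaternion algebras and norms\<close>

text \<open>Let the algebra act on K[s]/(s^2 - \<alpha>) with basis 1, s: \<open>e1\<close> acts as
  multiplication by s, and \<open>e2\<close> as conjugation followed by multiplication by x + y s,
  whose norm is \<beta>. In matrices this is \<open>h\<close>.\<close>

lemma split_quaternion_algebra_if_norm:
  fixes \<alpha> \<beta> :: "'k::field"
  assumes two: "(2::'k) \<noteq> 0" and \<alpha>: "\<alpha> \<noteq> 0" and \<beta>: "\<beta> \<noteq> 0" "\<beta> = x\<^sup>2 - \<alpha> * y\<^sup>2"
  shows "split_algebra (quaternion_algebra \<alpha> \<beta>)"
proof -
  define h :: "'k quat \<Rightarrow> 'k ^ 2 ^ 2" where
    "h = (\<lambda>u. case u of Quat a b c d \<Rightarrow>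
      vector [vector [a + x * c + \<alpha> * y * d, \<alpha> * b - \<alpha> * y * c - \<alpha> * x * d],
              vector [b + y * c + x * d, a - x * c - \<alpha> * y * d]])"
  \<comment> \<open>The matrix \<open>h u\<close> has rows (a + D, \<alpha> (b - E)) and (b + E, a -
    D), where D = x c + \<alpha> y d and E = y c + x d. Half sums and half differences of entries
    give a, b, D, E; Cramer's rule with determinant x^2 - \<alpha> y^2 = \<beta> then recovers c and
    d.\<close>
  define g :: "'k ^ 2 ^ 2 \<Rightarrow> 'k quat" where
    "g = (\<lambda>m. let D = (m $ 1 $ 1 - m $ 2 $ 2) / 2; E = (m $ 2 $ 1 - m $ 1 $ 2 / \<alpha>) / 2 in
      Quat ((m $ 1 $ 1 + m $ 2 $ 2) / 2) ((m $ 2 $ 1 + m $ 1 $ 2 / \<alpha>) / 2)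
           ((x * D - \<alpha> * y * E) / \<beta>) ((x * E - y * D) / \<beta>))"
  have half: "(s + t + (s - t)) / 2 = s" "(s + t - (s - t)) / 2 = t"
    "(s + t) / 2 + (s - t) / 2 = s" "(s + t) / 2 - (s - t) / 2 = t" for s t :: 'k
    using two by (simp_all add: field_simps flip: add_divide_distrib diff_divide_distrib)
  have "h (quat_mult \<alpha> \<beta> u v) = h u ** h v" for u v
    by (cases u; cases v)
      (simp add: h_def vec_eq_iff forall_2 matrix_matrix_mult_def sum_2 \<beta>(2) algebra_simps power2_eq_square)
  moreover have "h (quat_add u v) = h u + h v" for u v
    by (cases u; cases v) (simp add: h_def vec_eq_iff forall_2 algebra_simps)
  moreover have "h (Quat 1 0 0 0) = mat 1"
    by (simp add: h_def vec_eq_iff forall_2 mat_def)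
  ultimately have "h \<in> ring_hom (quaternion_algebra \<alpha> \<beta>) matrix_algebra2"
    by (auto intro!: ring_hom_memI simp: quaternion_algebra_def matrix_algebra2_def)
  moreover have "bij h"
  proof (rule o_bij)
    show "g \<circ> h = id"
    proof
      fix u :: "'k quat"
      obtain a b c d where u: "u = Quat a b c d" by (cases u)
      define D where "D = x * c + \<alpha> * y * d"
      define E where "E = y * c + x * d"
      have "(x * D - \<alpha> * y * E) / \<beta> = c" "(x * E - y * D) / \<beta> = d"
        using \<beta> by (simp_all add: D_def E_def divide_eq_eq) (simp_all add: algebra_simps power2_eq_square)
      moreover have "h u = vector [vector [a + D, \<alpha> * (b - E)], vector [b + E, a - D]]"
        by (simp add: h_def u D_def E_def algebra_simps)
      moreover have "(a + D + (a - D)) / 2 = a" "(a + D - (a - D)) / 2 = D"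
        "(b + E + (b - E)) / 2 = b" "(b + E - (b - E)) / 2 = E"
        by (simp_all only: half)
      ultimately show "(g \<circ> h) u = id u"
        using \<alpha> two by (simp add: g_def Let_def u mult.assoc)
    qed
    show "h \<circ> g = id"
    proof
      fix m :: "'k ^ 2 ^ 2"
      define A D B E where "A = (m $ 1 $ 1 + m $ 2 $ 2) / 2" and "D = (m $ 1 $ 1 - m $ 2 $ 2) / 2"
        and "B = (m $ 2 $ 1 + m $ 1 $ 2 / \<alpha>) / 2" and "E = (m $ 2 $ 1 - m $ 1 $ 2 / \<alpha>) / 2"
      define c where "c = (x * D - \<alpha> * y * E) / \<beta>"
      define d where "d = (x * E - y * D) / \<beta>"
      have m: "m $ 1 $ 1 = A + D" "m $ 2 $ 2 = A - D" "m $ 2 $ 1 = B + E" "m $ 1 $ 2 = \<alpha> * (B - E)"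
        using \<alpha> by (simp_all add: A_def B_def D_def E_def half)
      have "\<beta> * c = x * D - \<alpha> * y * E" "\<beta> * d = x * E - y * D"
        using \<beta>(1) by (simp_all add: c_def d_def)
      moreover have "\<beta> * (x * c + \<alpha> * y * d) = x * (\<beta> * c) + \<alpha> * y * (\<beta> * d)"
        "\<beta> * (y * c + x * d) = y * (\<beta> * c) + x * (\<beta> * d)"
        by (simp_all add: algebra_simps)
      moreover have "x * (x * D - \<alpha> * y * E) + \<alpha> * y * (x * E - y * D) = \<beta> * D"
        "y * (x * D - \<alpha> * y * E) + x * (x * E - y * D) = \<beta> * E"
        by (simp_all add: \<beta>(2) algebra_simps power2_eq_square)
      ultimately have "\<beta> * (x * c + \<alpha> * y * d) = \<beta> * D" "\<beta> * (y * c + x * d) = \<beta> * E"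
        by (simp_all only:)
      then have cd: "x * c + \<alpha> * y * d = D" "y * c + x * d = E"
        using \<beta>(1) by simp_all
      have "g m = Quat A B c d"
        by (simp add: g_def Let_def A_def B_def c_def d_def D_def E_def)
      then show "(h \<circ> g) m = id m"
        by (simp add: h_def vec_eq_iff forall_2 m flip: cd) (simp add: algebra_simps)
    qed
  qed
  moreover have "h (quat_scale t u) = map_matrix ((*) t) (h u)" for t u
    by (cases u) (simp add: h_def vec_eq_iff forall_2 map_matrix_def algebra_simps)
  ultimately have "h \<in> algebra_iso (quaternion_algebra \<alpha> \<beta>) matrix_algebra2"
    by (simp add: algebra_iso_def ring_iso_def quaternion_algebra_def matrix_algebra2_def)
  then show ?thesis
    by (auto simp: split_algebra_def)
qed

text \<open>Pulling back a nilpotent matrix gives u \<noteq> 0 with u^2 = 0. Its scalar part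
  vanishes, and what remains is \<beta> (c^2 - \<alpha> d^2) = -\<alpha> b^2. So \<beta> is a
  quotient of norms from K(sqrt \<alpha>), unless c^2 = \<alpha> d^2; then \<alpha> is a square and
  the norm form represents everything.\<close>

lemma norm_if_split_quaternion_algebra:
  fixes \<alpha> \<beta> :: "'k::field"
  assumes two: "(2::'k) \<noteq> 0" and \<alpha>: "\<alpha> \<noteq> 0" and \<beta>: "\<beta> \<noteq> 0"
    and split: "split_algebra (quaternion_algebra \<alpha> \<beta>)"
  obtains x y where "\<beta> = x\<^sup>2 - \<alpha> * y\<^sup>2"
proof -
  obtain h where h: "h \<in> ring_iso (quaternion_algebra \<alpha> \<beta>) (matrix_algebra2 :: ('k, 'k ^ 2 ^ 2) module)"
    using split by (auto simp: split_algebra_def algebra_iso_def)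
  have mult: "h (quat_mult \<alpha> \<beta> u v) = h u ** h v" and add: "h (quat_add u v) = h u + h v" for u v
    using h by (auto simp: ring_iso_def ring_hom_def quaternion_algebra_def matrix_algebra2_def)
  have bij: "bij h"
    using h by (auto simp: ring_iso_def quaternion_algebra_def matrix_algebra2_def)
  have zero: "h (Quat 0 0 0 0) = 0"
    using add[of "Quat 0 0 0 0" "Quat 0 0 0 0"] by simp
  define e :: "'k ^ 2 ^ 2" where "e = vector [vector [0, 1], vector [0, 0]]"
  have "e $ 1 $ 2 = 1"
    by (simp add: e_def)
  then have "e \<noteq> 0"
    by auto
  moreover have "e ** e = 0"
    by (simp add: e_def vec_eq_iff forall_2 matrix_matrix_mult_def sum_2)
  moreover obtain u where u: "h u = e"
    using bij by (metis bij_pointE)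
  ultimately have "h (quat_mult \<alpha> \<beta> u u) = h (Quat 0 0 0 0)" "u \<noteq> Quat 0 0 0 0"
    using mult zero by auto
  then have sq: "quat_mult \<alpha> \<beta> u u = Quat 0 0 0 0"
    using bij by (auto dest: bij_is_inj injD)
  obtain a b c d where abcd: "u = Quat a b c d" by (cases u)
  have *: "a * a + \<alpha> * b * b + \<beta> * c * c - \<alpha> * \<beta> * d * d = 0"
    "2 * (a * b) = 0" "2 * (a * c) = 0" "2 * (a * d) = 0"
    using sq by (simp_all add: abcd algebra_simps)
  \<comment> \<open>If a were nonzero, 2 \<noteq> 0 would force b = c = d = 0, and the first
    equation would give a = 0.\<close>
  have "a = 0"
    using * two by (cases "a = 0") auto
  define n where "n = c\<^sup>2 - \<alpha> * d\<^sup>2"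
  have n: "\<beta> * n = - \<alpha> * b\<^sup>2"
    using *(1) \<open>a = 0\<close> by (simp add: n_def algebra_simps power2_eq_square eq_neg_iff_add_eq_0)
  show thesis
  proof (cases "n = 0")
    case False
    \<comment> \<open>With s^2 = \<alpha>, the right side is the norm of b s (c + d s) = \<alpha> b
      d + b c s.\<close>
    have "\<beta> * n * n = (\<alpha> * b * d)\<^sup>2 - \<alpha> * (b * c)\<^sup>2"
      unfolding n by (simp add: n_def algebra_simps power2_eq_square)
    then have "\<beta> = (\<alpha> * b * d / n)\<^sup>2 - \<alpha> * (b * c / n)\<^sup>2"
      using False by (simp add: field_simps power2_eq_square)
    then show thesis by (rule that)
  next
    case True
    then have "b = 0" using n \<alpha> by simp
    then have "c \<noteq> 0 \<or> d \<noteq> 0"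
      using \<open>u \<noteq> _\<close> \<open>a = 0\<close> by (simp add: abcd)
    then have "d \<noteq> 0" "c \<noteq> 0"
      using True \<alpha> by (auto simp: n_def)
    define r where "r = c / d"
    have "\<alpha> = r\<^sup>2" "r \<noteq> 0"
      using True \<open>d \<noteq> 0\<close> \<open>c \<noteq> 0\<close> by (simp_all add: n_def r_def field_simps)
    \<comment> \<open>Now x^2 - \<alpha> y^2 = (x - r y) (x + r y); making the factors 1 and \<beta>
      gives x = t + 1 and r y = t.\<close>
    define t where "t = (\<beta> - 1) / 2"
    then have "t * 2 = \<beta> - 1"
      using two nonzero_eq_divide_eq[of 2 t "\<beta> - 1"] by simp
    then have "\<beta> = 2 * t + 1"
      by (simp add: algebra_simps)
    also have "\<dots> = (t + 1)\<^sup>2 - \<alpha> * (t / r)\<^sup>2"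
      using \<open>\<alpha> = r\<^sup>2\<close> \<open>r \<noteq> 0\<close> by (simp add: power_divide) (simp add: power2_eq_square algebra_simps)
    finally show thesis by (rule that)
  qed
qed


subsection \<open>The equation \<open>x\<^sup>2 + p * y\<^sup>2 = q * z\<^sup>2\<close>\<close>

lemma thue:
  fixes q :: nat and t :: int
  assumes "q > 0"
  obtains x y :: int
  where "(x, y) \<noteq> (0, 0)" "x\<^sup>2 \<le> int q" "y\<^sup>2 \<le> int q" "[x = t * y] (mod int q)"
proof -
  \<comment> \<open>There are (s + 1)^2 > q pairs with entries in 0..s, so two of them agree in i -
    t j modulo q. Their difference is the required (x, y), with entries at most s in absolute
    value.\<close>
  define s where "s = nat \<lfloor>sqrt q\<rfloor>"
  have s: "s\<^sup>2 \<le> q" "q < (Suc s)\<^sup>2"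
  proof -
    have "real s \<le> sqrt q" "sqrt q < real s + 1"
      unfolding s_def by (simp_all add: of_nat_nat)
    then have "(real s)\<^sup>2 \<le> (sqrt q)\<^sup>2" "(sqrt q)\<^sup>2 < (real s + 1)\<^sup>2"
      by (intro power_mono power_strict_mono; simp)+
    then have "real (s\<^sup>2) \<le> real q" "real q < real ((Suc s)\<^sup>2)"
      by (simp_all add: add.commute)
    then show "s\<^sup>2 \<le> q" "q < (Suc s)\<^sup>2"
      by (simp_all only: of_nat_le_iff of_nat_less_iff)
  qed
  define f where "f = (\<lambda>(i, j). (int i - t * int j) mod int q)"
  have "card (f ` ({..s} \<times> {..s})) \<le> card {0..<int q}"
    using assms by (intro card_mono) (auto simp: f_def)
  also have "\<dots> < card ({..s} \<times> {..s})"
    using s(2) by (simp add: power2_eq_square)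
  finally have "\<not> inj_on f ({..s} \<times> {..s})"
    by (rule pigeonhole)
  then obtain i j k l where ij: "i \<le> s" "j \<le> s" "k \<le> s" "l \<le> s" "(i, j) \<noteq> (k, l)"
    "(int i - t * int j) mod int q = (int k - t * int l) mod int q"
    by (auto simp: inj_on_def f_def)
  have le: "(int a - int b)\<^sup>2 \<le> int q" if "a \<le> s" "b \<le> s" for a b
  proof -
    have "\<bar>int a - int b\<bar> \<le> int s" using that by linarith
    then have "(int a - int b)\<^sup>2 \<le> (int s)\<^sup>2"
      using abs_le_square_iff[of "int a - int b" "int s"] by simp
    also have "\<dots> \<le> int q" using s(1) by (simp flip: of_nat_power)
    finally show ?thesis .
  qed
  show thesis
  proof (rule that[of "int i - int k" "int j - int l"])
    show "(int i - int k, int j - int l) \<noteq> (0, 0)" using ij(5) by simp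
    show "[int i - int k = t * (int j - int l)] (mod int q)"
      using ij(6) by (simp add: cong_def mod_eq_dvd_iff algebra_simps)
  qed (use ij le in auto)
qed

text \<open>Euler's criterion for -p and for p gives (-p/q) = (-1)^((q-1)/2) (p/q), and reciprocity
  with (q/p) = 1 evaluates (p/q). The total exponent of -1 is (q-1)/2 * ((p-1)/2 + 1), which
  \<open>mod4\<close> makes even.\<close>

lemma QuadRes_minus_prime:
  fixes p q :: nat
  assumes p: "prime p" "2 < p" and q: "prime q" "2 < q" "p \<noteq> q"
    and mod4: "p mod 4 = 3 \<or> q mod 4 = 1" and res: "QuadRes p q"
  shows "QuadRes q (- int p)"
proof -
  have ne0: "\<not> [int a = 0] (mod int b)" if "prime a" "prime b" "a \<noteq> b" for a b
    using that primes_dvd_imp_eq[of b a] by (auto simp: cong_0_iff)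
  have odd: "odd p" "odd q"
    using p q by (auto simp: prime_odd_nat)
  have "Legendre q p = 1"
    using res ne0[of q p] p q by (simp add: Legendre_def)
  then have L: "Legendre p q = (- 1) ^ ((p - 1) div 2 * ((q - 1) div 2))"
    using Quadratic_Reciprocity[OF p q] by simp
  have "[Legendre (- int p) q = (- int p) ^ ((q - 1) div 2)] (mod int q)"
    using euler_criterion[OF q(1,2)] .
  also have "(- int p) ^ ((q - 1) div 2) = (- 1) ^ ((q - 1) div 2) * int p ^ ((q - 1) div 2)"
    by (simp flip: power_mult_distrib)
  also have "[\<dots> = (- 1) ^ ((q - 1) div 2) * Legendre p q] (mod int q)"
    using euler_criterion[OF q(1,2), of "int p"] by (intro cong_mult cong_refl) (rule cong_sym)
  also have "(- 1) ^ ((q - 1) div 2) * Legendre p q = 1"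
  proof (cases "even ((q - 1) div 2)")
    case True
    then show ?thesis by (simp add: L)
  next
    case False
    then have "q mod 4 \<noteq> 1" by presburger
    then have "odd ((p - 1) div 2)" using mod4 by presburger
    then show ?thesis using False by (simp add: L)
  qed
  finally have "int q dvd Legendre (- int p) q - 1"
    by (simp add: cong_iff_dvd_diff)
  \<comment> \<open>Legendre symbols lie in {-1, 0, 1}, and q > 2 divides neither -2 nor -1, so the
    congruence is an equality.\<close>
  moreover have "\<not> int q dvd 2"
    using q by (auto dest: zdvd_imp_le)
  ultimately have "Legendre (- int p) q \<noteq> - 1" "Legendre (- int p) q \<noteq> 0"
    using q by auto
  then show ?thesis
    by (auto simp: Legendre_def split: if_splits)
qed

lemma small_multiple_represented:
  fixes p q :: nat
  assumes p: "prime p" "2 < p" and q: "prime q" "2 < q" "p \<noteq> q"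
    and mod4: "p mod 4 = 3 \<or> q mod 4 = 1" and res: "QuadRes p q"
  obtains x y k :: int
  where "x\<^sup>2 + int p * y\<^sup>2 = k * int q" "1 \<le> k" "k \<le> int p"
proof -
  obtain t where t: "[t\<^sup>2 = - int p] (mod int q)"
    using QuadRes_minus_prime[OF assms] by (auto simp: QuadRes_def)
  obtain x y where xy: "(x, y) \<noteq> (0, 0)" "x\<^sup>2 \<le> int q" "y\<^sup>2 \<le> int q" "[x = t * y] (mod int q)"
    using thue[of q t] q by auto
  \<comment> \<open>A prime is not a square, so the bounds from Thue's lemma are strict. Hence x^2 +
    p y^2 < (p + 1) q, and k stops at p instead of p + 1.\<close>
  have ne: "z\<^sup>2 \<noteq> int q" for z
  proof
    assume z: "z\<^sup>2 = int q"
    then have "(nat \<bar>z\<bar>)\<^sup>2 = q"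
      by (metis abs_ge_zero nat_0_le of_nat_eq_iff of_nat_power power2_abs)
    then show False
      using q(1) prime_power_iff[of "nat \<bar>z\<bar>" 2] by simp
  qed
  have "[x\<^sup>2 + int p * y\<^sup>2 = (t * y)\<^sup>2 + int p * y\<^sup>2] (mod int q)"
    using xy(4) by (intro cong_add cong_pow cong_refl)
  also have "(t * y)\<^sup>2 + int p * y\<^sup>2 = (t\<^sup>2 + int p) * y\<^sup>2"
    by (simp add: algebra_simps power_mult_distrib)
  also have "[\<dots> = (- int p + int p) * y\<^sup>2] (mod int q)"
    using t by (intro cong_mult cong_add cong_refl)
  finally have "int q dvd x\<^sup>2 + int p * y\<^sup>2"
    by (simp add: cong_0_iff)
  then obtain k where k: "x\<^sup>2 + int p * y\<^sup>2 = int q * k" ..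
  have "0 < x\<^sup>2 + int p * y\<^sup>2"
    using xy(1) p by (cases "x = 0") (auto intro: add_pos_nonneg)
  then have "1 \<le> k"
    using k q by (simp add: zero_less_mult_iff)
  have "x\<^sup>2 < int q" "y\<^sup>2 < int q"
    using xy ne by (simp_all add: order_less_le)
  then have "x\<^sup>2 + int p * y\<^sup>2 < int q + int p * int q"
    by (intro add_less_le_mono mult_left_mono) auto
  then have "int q * k < int q * (int p + 1)"
    unfolding k by (simp add: algebra_simps)
  then have "k \<le> int p"
    using q by (simp add: mult_less_cancel_left)
  show thesis
    using that[of x y k] k \<open>1 \<le> k\<close> \<open>k \<le> int p\<close> by (simp add: mult.commute)
qed

section \<open>Primitive integer solutions and the necessary congruences\<close>

lemma primitive_integer_solution:
  fixes p c :: int and a b :: rat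
  assumes "of_int c = a\<^sup>2 + of_int p * b\<^sup>2"
  obtains x y z :: int
  where "x\<^sup>2 + p * y\<^sup>2 = c * z\<^sup>2" "\<And>d. d dvd x \<Longrightarrow> d dvd y \<Longrightarrow> d dvd z \<Longrightarrow> \<bar>d\<bar> = 1"
proof -
  define S where "S = {z :: int. z > 0 \<and> (\<exists>x y. x\<^sup>2 + p * y\<^sup>2 = c * z\<^sup>2)}"
  obtain m n where m: "a = of_int m / of_int n" "n > 0"
    by (metis Rat_cases_nonzero Rat_cases Fract_of_int_quotient)
  obtain m' n' where m': "b = of_int m' / of_int n'" "n' > 0"
    by (metis Rat_cases Fract_of_int_quotient)
  have "(of_int (c * (n * n')\<^sup>2) :: rat) = of_int ((m * n')\<^sup>2 + p * (m' * n)\<^sup>2)"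
  proof -
    have "of_int m = a * of_int n" "of_int m' = b * of_int n'"
      using m m' by simp_all
    then show ?thesis
      by (simp add: assms algebra_simps power_mult_distrib)
  qed
  then have "(m * n')\<^sup>2 + p * (m' * n)\<^sup>2 = c * (n * n')\<^sup>2"
    by (simp only: of_int_eq_iff)
  then have "n * n' \<in> S"
    using m m' by (auto simp: S_def)
  \<comment> \<open>Minimality yields primitivity: cancelling a common divisor d divides z by |d|,
    so |d| > 1 would give a smaller positive z.\<close>
  then obtain z where z: "z \<in> S" and min: "\<And>w. w \<in> S \<Longrightarrow> nat z \<le> nat w"
    using ex_has_least_nat[of "\<lambda>w. w \<in> S" "n * n'" nat] by auto
  then obtain x y where xy: "x\<^sup>2 + p * y\<^sup>2 = c * z\<^sup>2" and "z > 0"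
    by (auto simp: S_def)
  show thesis
  proof (rule that[OF xy])
    fix d assume "d dvd x" "d dvd y" "d dvd z"
    then have d: "\<bar>d\<bar> dvd x" "\<bar>d\<bar> dvd y" "\<bar>d\<bar> dvd z" by auto
    then obtain x' y' z' where e: "x = \<bar>d\<bar> * x'" "y = \<bar>d\<bar> * y'" "z = \<bar>d\<bar> * z'"
      unfolding dvd_def by blast
    have "\<bar>d\<bar> > 0" "z' > 0"
      using \<open>z > 0\<close> e(3) by (auto simp: zero_less_mult_iff)
    moreover have "\<bar>d\<bar>\<^sup>2 * (x'\<^sup>2 + p * y'\<^sup>2) = \<bar>d\<bar>\<^sup>2 * (c * z'\<^sup>2)"
      using xy unfolding e by (simp only: power_mult_distrib algebra_simps)
    then have "x'\<^sup>2 + p * y'\<^sup>2 = c * z'\<^sup>2"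
      using \<open>\<bar>d\<bar> > 0\<close> by simp
    ultimately have "z' \<in> S" by (auto simp: S_def)
    then have "\<bar>d\<bar> * z' \<le> 1 * z'"
      using min[of z'] e(3) \<open>z > 0\<close> by linarith
    then show "\<bar>d\<bar> = 1"
      using \<open>z' > 0\<close> \<open>\<bar>d\<bar> > 0\<close> by (simp add: mult_le_cancel_right)
  qed
qed

text \<open>If p does not divide z, then z is invertible modulo p and q = (x / z)^2 there. If p
  divides z, it divides x; then p^2 divides p y^2 = q z^2 - x^2, so p divides y too, against
  primitivity.\<close>

lemma QuadRes_if_norm:
  fixes p q :: nat and a b :: rat
  assumes p: "prime p" and q: "prime q" "p \<noteq> q"
    and norm: "of_nat q = a\<^sup>2 + of_nat p * b\<^sup>2"
  shows "QuadRes p q"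
proof -
  obtain x y z where xyz: "x\<^sup>2 + int p * y\<^sup>2 = int q * z\<^sup>2"
    and prim: "\<And>d. d dvd x \<Longrightarrow> d dvd y \<Longrightarrow> d dvd z \<Longrightarrow> \<bar>d\<bar> = 1"
    using primitive_integer_solution[of "int q" a "int p" b] norm by auto
  have pp: "prime (int p)" using p by simp
  have "\<not> int p dvd z"
  proof
    assume "int p dvd z"
    then have "int p dvd int q * z\<^sup>2 - int p * y\<^sup>2"
      by (intro dvd_diff) (auto simp: power2_eq_square)
    then have "int p dvd x\<^sup>2" by (simp flip: xyz)
    then have "int p dvd x" using pp prime_dvd_power by blast
    then have "(int p)\<^sup>2 dvd x\<^sup>2" "(int p)\<^sup>2 dvd z\<^sup>2"
      using \<open>int p dvd z\<close> by simp_all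
    then have "int p * int p dvd int q * z\<^sup>2 - x\<^sup>2"
      unfolding power2_eq_square[of "int p"] by (intro dvd_diff dvd_mult)
    then have "int p * int p dvd int p * y\<^sup>2"
      by (simp flip: xyz)
    then have "int p dvd y\<^sup>2"
      using p by (auto simp: prime_gt_0_nat)
    then have "int p dvd y" using pp prime_dvd_power by blast
    from prim[OF \<open>int p dvd x\<close> this \<open>int p dvd z\<close>] p show False
      by simp
  qed
  then have "coprime z (int p)"
    using prime_imp_coprime[OF pp] by (simp add: coprime_commute)
  then obtain w where w: "[z * w = 1] (mod int p)"
    using cong_solve_coprime_int by blast
  have "[(x * w)\<^sup>2 = x\<^sup>2 * w\<^sup>2 + int p * (y\<^sup>2 * w\<^sup>2)] (mod int p)"
    by (simp add: power_mult_distrib cong_def)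
  also have "x\<^sup>2 * w\<^sup>2 + int p * (y\<^sup>2 * w\<^sup>2) = (x\<^sup>2 + int p * y\<^sup>2) * w\<^sup>2"
    by (simp add: algebra_simps)
  also have "\<dots> = int q * (z * w)\<^sup>2"
    unfolding xyz by (simp add: power_mult_distrib)
  also have "[\<dots> = int q * 1\<^sup>2] (mod int p)"
    using w by (intro cong_mult cong_pow cong_refl)
  finally show ?thesis
    by (auto simp: QuadRes_def)
qed

lemma square_mod_4: "(x::int)\<^sup>2 mod 4 = of_bool (odd x)"
proof (cases "even x")
  case True
  then show ?thesis by (auto elim!: evenE simp: power2_eq_square)
next
  case False
  then obtain m where "x = 2 * m + 1" by (auto elim: oddE)
  then have "x\<^sup>2 = 4 * (m\<^sup>2 + m) + 1" by (simp add: power2_eq_square algebra_simps)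
  then have "x\<^sup>2 mod 4 = 1" by presburger
  with False show ?thesis by simp
qed

text \<open>Otherwise the equation reads x^2 + y^2 + z^2 = 0 modulo 4. Squares are 0 or 1 there, so
  x, y, z are all even, against primitivity.\<close>

lemma mod_4_ne_3_if_norm:
  fixes p q :: nat and a b :: rat
  assumes "p mod 4 = 1" and norm: "of_nat q = a\<^sup>2 + of_nat p * b\<^sup>2"
  shows "q mod 4 \<noteq> 3"
proof
  assume "q mod 4 = 3"
  obtain x y z where xyz: "x\<^sup>2 + int p * y\<^sup>2 = int q * z\<^sup>2"
    and prim: "\<And>d. d dvd x \<Longrightarrow> d dvd y \<Longrightarrow> d dvd z \<Longrightarrow> \<bar>d\<bar> = 1"
    using primitive_integer_solution[of "int q" a "int p" b] norm by auto
  have "int p mod 4 = 1" "int q mod 4 = 3"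
    using assms(1) \<open>q mod 4 = 3\<close> by presburger+
  then have "(x\<^sup>2 mod 4 + y\<^sup>2 mod 4) mod 4 = 3 * (z\<^sup>2 mod 4) mod 4"
    using arg_cong[OF xyz, of "\<lambda>n. n mod 4"] 
    by (metis mod_add_eq mod_mult_eq mult_1 mod_mod_trivial)
  then have "even x" "even y" "even z"
    by (cases "even x"; cases "even y"; cases "even z"; simp add: square_mod_4)+
  with prim[of 2] show False by simp
qed

section \<open>Quotients of norms and the splitting criterion\<close>

lemma norm_cancel:
  fixes c k q a b x y :: "'k::field"
  assumes "k * q = x\<^sup>2 + c * y\<^sup>2" "k = a\<^sup>2 + c * b\<^sup>2" "k \<noteq> 0"
  shows "q = ((a * x + c * b * y) / k)\<^sup>2 + c * ((a * y - b * x) / k)\<^sup>2"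
proof -
  \<comment> \<open>With s^2 = -c, the coordinates are those of (x + y s) / (a + b s) = (x + y s) (a
    - b s) / k, and the norm is multiplicative.\<close>
  have "k\<^sup>2 * q = k * (x\<^sup>2 + c * y\<^sup>2)"
    unfolding assms(1)[symmetric] by (simp add: power2_eq_square)
  also have "\<dots> = (a * x + c * b * y)\<^sup>2 + c * (a * y - b * x)\<^sup>2"
    by (simp add: assms(2) power2_eq_square algebra_simps)
  finally have "q = ((a * x + c * b * y)\<^sup>2 + c * (a * y - b * x)\<^sup>2) / k\<^sup>2"
    using assms(3) by (metis nonzero_mult_div_cancel_left power_not_zero)
  then show ?thesis
    by (simp only: power_divide add_divide_distrib [of _ _ "k\<^sup>2"] times_divide_eq_right)
qed


text \<open>For the primes p in question: n is a norm from the field Q(sqrt(-p)).\<close>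

definition rat_norm :: "nat \<Rightarrow> nat \<Rightarrow> bool" where
  "rat_norm p n \<longleftrightarrow> (\<exists>a b :: rat. of_nat n = a\<^sup>2 + of_nat p * b\<^sup>2)"

lemma rat_normI: "of_nat n = (a::rat)\<^sup>2 + of_nat p * b\<^sup>2 \<Longrightarrow> rat_norm p n"
  by (auto simp: rat_norm_def)

lemma rat_norm_self: "rat_norm p p"
  by (rule rat_normI[of _ 0 _ 1]) simp

lemma split_iff_rat_norm:
  assumes "p > 0" "q > 0"
  shows "split_algebra (quaternion_algebra (- of_nat p :: rat) (of_nat q)) \<longleftrightarrow> rat_norm p q"
proof
  assume "split_algebra (quaternion_algebra (- of_nat p :: rat) (of_nat q))"
  then obtain x y :: rat where "of_nat q = x\<^sup>2 - (- of_nat p) * y\<^sup>2"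
    using norm_if_split_quaternion_algebra[of "- of_nat p :: rat" "of_nat q"] assms by auto
  then show "rat_norm p q" by (intro rat_normI[of _ x _ y]) simp
next
  assume "rat_norm p q"
  then obtain a b :: rat where "of_nat q = a\<^sup>2 + of_nat p * b\<^sup>2"
    by (auto simp: rat_norm_def)
  then show "split_algebra (quaternion_algebra (- of_nat p :: rat) (of_nat q))"
    using assms by (intro split_quaternion_algebra_if_norm[of _ _ a b]) auto
qed

subsection \<open>Quadratic residues and the four cases\<close>

lemma square_mod_range:
  fixes x m :: int
  assumes "m > 0"
  shows "x\<^sup>2 mod m \<in> (\<lambda>i. i\<^sup>2 mod m) ` {0..m - 1}"
  using assms by (intro image_eqI[of _ _ "x mod m"]) (auto simp: power_mod)

text \<open>For a concrete modulus this turns quadratic residues into a finite table that can be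
  evaluated.\<close>

lemma QuadRes_iff_range:
  assumes "m > 0"
  shows "QuadRes m a \<longleftrightarrow> a mod m \<in> (\<lambda>i. i\<^sup>2 mod m) ` {0..m - 1}"
proof
  assume "QuadRes m a"
  then obtain y where "y\<^sup>2 mod m = a mod m" by (auto simp: QuadRes_def cong_def)
  then show "a mod m \<in> (\<lambda>i. i\<^sup>2 mod m) ` {0..m - 1}"
    using square_mod_range[OF assms, of y] by simp
next
  assume "a mod m \<in> (\<lambda>i. i\<^sup>2 mod m) ` {0..m - 1}"
  then obtain y where "a mod m = y\<^sup>2 mod m" by blast
  then show "QuadRes m a" unfolding QuadRes_def cong_def by metis
qed

lemma QuadRes_if_represented:
  fixes x y :: int
  assumes "x\<^sup>2 + int p * y\<^sup>2 = int n"
  shows "QuadRes (int p) (int n)"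
proof -
  have "[x\<^sup>2 = int n] (mod int p)"
    unfolding assms[symmetric] by (simp add: cong_def)
  then show ?thesis by (auto simp: QuadRes_def)
qed

text \<open>Some k q with k \<le> p is represented, so by \<open>norm_cancel\<close> it suffices
  that this k is a norm; the test modulo p discards many k. The equation stays available in
  \<open>mult\<close> for p = 13, where that test is too weak.\<close>

lemma rat_norm_if_multiples:
  fixes p q :: nat
  assumes "prime p" "2 < p" "prime q" "2 < q" "p \<noteq> q"
    and "p mod 4 = 3 \<or> q mod 4 = 1" "QuadRes p q"
    and mult: "\<And>k x y. k \<in> {1..p} \<Longrightarrow> QuadRes p (int (k * q)) \<Longrightarrow>
      x\<^sup>2 + int p * y\<^sup>2 = int (k * q) \<Longrightarrow> rat_norm p k"
  shows "rat_norm p q"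
proof -
  obtain x y k' where xy: "x\<^sup>2 + int p * y\<^sup>2 = k' * int q" and "1 \<le> k'" "k' \<le> int p"
    using small_multiple_represented assms(1-7) by blast
  define k where "k = nat k'"
  have k: "k \<in> {1..p}" "k' = int k"
    using \<open>1 \<le> k'\<close> \<open>k' \<le> int p\<close> by (auto simp: k_def)
  have eq: "x\<^sup>2 + int p * y\<^sup>2 = int (k * q)"
    using xy k by simp
  then obtain a b :: rat where ab: "of_nat k = a\<^sup>2 + of_nat p * b\<^sup>2"
    using mult[OF k(1) QuadRes_if_represented[OF eq] eq] by (auto simp: rat_norm_def)
  have "(of_int (x\<^sup>2 + int p * y\<^sup>2) :: rat) = of_int (int (k * q))"
    unfolding eq ..
  then have "(of_nat k :: rat) * of_nat q = (of_int x)\<^sup>2 + of_nat p * (of_int y)\<^sup>2"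
    by simp
  from rat_normI[OF norm_cancel[OF this ab]] k(1) show ?thesis
    by simp
qed

lemma QuadRes_if_rat_norm:
  assumes "prime p" "prime q" "p \<noteq> q" "rat_norm p q"
  shows "QuadRes (int p) (int q)"
  using assms QuadRes_if_norm by (auto simp: rat_norm_def)

lemma mod_4_eq_1_if_rat_norm:
  assumes "p mod 4 = 1" "prime q" "q \<noteq> 2" "rat_norm p q"
  shows "q mod 4 = 1"
proof -
  have "odd q"
    using assms(2,3) prime_odd_nat[of q] prime_ge_2_nat[of q] by linarith
  moreover have "q mod 4 \<noteq> 3"
    using assms(1,4) mod_4_ne_3_if_norm by (auto simp: rat_norm_def)
  ultimately show ?thesis by presburger
qed

text \<open>The residue 0 occurs because \<open>QuadRes\<close> counts multiples of the modulus as
  squares; it lets k = p pass the test.\<close>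

lemma QuadRes_3: "QuadRes 3 (int n) \<longleftrightarrow> n mod 3 \<in> {0, 1}"
  and QuadRes_5: "QuadRes 5 (int n) \<longleftrightarrow> n mod 5 \<in> {0, 1, 4}"
  and QuadRes_7: "QuadRes 7 (int n) \<longleftrightarrow> n mod 7 \<in> {0, 1, 2, 4}"
  and QuadRes_13: "QuadRes 13 (int n) \<longleftrightarrow> n mod 13 \<in> {0, 1, 3, 4, 9, 10, 12}"
proof -
  have int_mod: "int n mod numeral k = int (n mod numeral k)" for k
    by (simp add: zmod_int)
  show "QuadRes 3 (int n) \<longleftrightarrow> n mod 3 \<in> {0, 1}"
    by (simp add: QuadRes_iff_range int_mod simp_from_to)
  show "QuadRes 5 (int n) \<longleftrightarrow> n mod 5 \<in> {0, 1, 4}"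
    by (simp add: QuadRes_iff_range int_mod simp_from_to) blast
  show "QuadRes 7 (int n) \<longleftrightarrow> n mod 7 \<in> {0, 1, 2, 4}"
    by (simp add: QuadRes_iff_range int_mod simp_from_to) blast
  show "QuadRes 13 (int n) \<longleftrightarrow> n mod 13 \<in> {0, 1, 3, 4, 9, 10, 12}"
    by (simp add: QuadRes_iff_range int_mod simp_from_to) blast
qed

lemma square_mod_16: "(x::int)\<^sup>2 mod 16 \<in> {0, 1, 4, 9}"
  using square_mod_range[of 16 x] by (simp add: simp_from_to) blast

lemma prime_mod_ne_0:
  fixes p q :: nat
  assumes "prime p" "prime q" "p \<noteq> q"
  shows "q mod p \<noteq> 0"
  using assms primes_dvd_imp_eq by (auto simp: mod_eq_0_iff_dvd)

section \<open>The four primes p = 3, 5, 7, 13\<close>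

lemma rat_norm_3_iff:
  assumes q: "prime q"
  shows "rat_norm 3 q \<longleftrightarrow> q mod 3 = 1 \<or> q = 3"
proof (cases "q = 3")
  case True
  then show ?thesis by (simp add: rat_norm_self)
next
  case False
  show ?thesis
  proof
    assume "rat_norm 3 q"
    then show "q mod 3 = 1 \<or> q = 3"
      using QuadRes_if_rat_norm[of 3 q] prime_mod_ne_0[of 3 q] q False by (auto simp: QuadRes_3)
  next
    assume "q mod 3 = 1 \<or> q = 3"
    then have q3: "q mod 3 = 1" using False by simp
    then have "2 < q"
      using prime_ge_2_nat[OF q] by (cases "q = 2") auto
    show "rat_norm 3 q"
    proof (rule rat_norm_if_multiples)
      fix k assume "k \<in> {1..3}" and "QuadRes (int 3) (int (k * q))"
      then have "(k * q) mod 3 \<in> {0, 1}"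
        by (simp only: QuadRes_3 of_nat_numeral)
      then have "(k * 1) mod 3 \<in> {0, 1}"
        by (metis q3 mod_mult_right_eq)
      moreover have "k \<in> {1, 2, 3}" using \<open>k \<in> {1..3}\<close> by auto
      ultimately have "k = 1 \<or> k = 3" by auto
      then show "rat_norm 3 k"
        using rat_normI[of 1 1 3 0] rat_norm_self[of 3] by auto
    qed (use q q3 False \<open>2 < q\<close> in \<open>auto simp: QuadRes_3\<close>)
  qed
qed

lemma rat_norm_5_iff:
  assumes q: "prime q"
  shows "rat_norm 5 q \<longleftrightarrow> q mod 20 \<in> {1, 9} \<or> q = 5"
proof (cases "q = 5")
  case True
  then show ?thesis by (simp add: rat_norm_self)
next
  case False
  \<comment> \<open>The list modulo 20 combines two conditions, a nonzero square modulo 5 and 1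
    modulo 4; all 20 remainders are checked.\<close>
  have "\<forall>r\<in>{..<20::nat}. r \<in> {1, 9} \<longleftrightarrow> r mod 5 \<in> {1, 4} \<and> r mod 4 = 1"
    by code_simp
  then have "q mod 20 \<in> {1, 9} \<longleftrightarrow> q mod 20 mod 5 \<in> {1, 4} \<and> q mod 20 mod 4 = 1"
    by (rule bspec) simp
  then have mod20: "q mod 20 \<in> {1, 9} \<longleftrightarrow> q mod 5 \<in> {1, 4} \<and> q mod 4 = 1"
    by (simp add: mod_mod_cancel)
  show ?thesis
  proof
    assume *: "rat_norm 5 q"
    have "q mod 5 \<in> {1, 4}"
      using QuadRes_if_rat_norm[of 5 q] prime_mod_ne_0[of 5 q] * q False by (auto simp: QuadRes_5)
    \<comment> \<open>The residue modulo 5 excludes q = 2.\<close>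
    moreover from this have "q mod 4 = 1"
      using mod_4_eq_1_if_rat_norm[of 5 q] * q by (cases "q = 2") auto
    ultimately show "q mod 20 \<in> {1, 9} \<or> q = 5"
      using mod20 by blast
  next
    assume "q mod 20 \<in> {1, 9} \<or> q = 5"
    then have q5: "q mod 5 \<in> {1, 4}" and q4: "q mod 4 = 1"
      using False mod20 by blast+
    then have "2 < q"
      using prime_ge_2_nat[OF q] by (cases "q = 2") auto
    show "rat_norm 5 q"
    proof (rule rat_norm_if_multiples)
      fix k assume "k \<in> {1..5}" and "QuadRes (int 5) (int (k * q))"
      then have "(k * q) mod 5 \<in> {0, 1, 4}"
        by (simp only: QuadRes_5 of_nat_numeral)
      then have "(k * (q mod 5)) mod 5 \<in> {0, 1, 4}"
        by (simp only: mod_mult_right_eq)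
      moreover have "k \<in> {1, 2, 3, 4, 5}" using \<open>k \<in> {1..5}\<close> by auto
      \<comment> \<open>As q is a nonzero square modulo 5, k must be a square or 0 there, which
        discards 2 and 3. The survivors 1 = 1^2, 4 = 2^2 and 5 are norms.\<close>
      ultimately have "k = 1 \<or> k = 4 \<or> k = 5" using q5 by auto
      then show "rat_norm 5 k"
        using rat_normI[of 1 1 5 0] rat_normI[of 4 2 5 0] rat_norm_self[of 5] by auto
    qed (use q q4 q5 False \<open>2 < q\<close> in \<open>auto simp: QuadRes_5\<close>)
  qed
qed

lemma rat_norm_7_iff:
  assumes q: "prime q"
  shows "rat_norm 7 q \<longleftrightarrow> q mod 7 \<in> {1, 2, 4} \<or> q = 7"
proof (cases "q = 7")
  case True
  then show ?thesis by (simp add: rat_norm_self)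
next
  case False
  \<comment> \<open>2 is the norm of (1 + sqrt(-7)) / 2; the denominators are essential, since x^2 +
    7 y^2 = 2 has no integer solution.\<close>
  have two: "rat_norm 7 2"
    by (rule rat_normI[of _ "1/2" _ "1/2"]) (simp add: power2_eq_square)
  show ?thesis
  proof
    assume "rat_norm 7 q"
    then show "q mod 7 \<in> {1, 2, 4} \<or> q = 7"
      using QuadRes_if_rat_norm[of 7 q] prime_mod_ne_0[of 7 q] q False by (auto simp: QuadRes_7)
  next
    assume "q mod 7 \<in> {1, 2, 4} \<or> q = 7"
    then have q7: "q mod 7 = 1 \<or> q mod 7 = 2 \<or> q mod 7 = 4" using False by simp
    show "rat_norm 7 q"
    proof (cases "q = 2")
      case True
      then show ?thesis using two by simp
    next
      case False
      then have "2 < q"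
        using prime_ge_2_nat[OF q] by simp
      show ?thesis
      proof (rule rat_norm_if_multiples)
        fix k assume "k \<in> {1..7}" and "QuadRes (int 7) (int (k * q))"
        then have "(k * q) mod 7 \<in> {0, 1, 2, 4}"
          by (simp only: QuadRes_7 of_nat_numeral)
        then have "(k * (q mod 7)) mod 7 \<in> {0, 1, 2, 4}"
          by (simp only: mod_mult_right_eq)
        moreover have "k \<in> {1, 2, 3, 4, 5, 6, 7}" using \<open>k \<in> {1..7}\<close> by auto
        ultimately have "k = 1 \<or> k = 2 \<or> k = 4 \<or> k = 7" using q7 by auto
        then show "rat_norm 7 k"
          using rat_normI[of 1 1 7 0] two rat_normI[of 4 2 7 0] rat_norm_self[of 7] by auto
      qed (use q q7 \<open>q \<noteq> 7\<close> \<open>2 < q\<close> in \<open>auto simp: QuadRes_7\<close>)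
    qed
  qed
qed

text \<open>The test modulo 13 also lets k = 3, 10, 12 pass; these are excluded modulo 16. The
  alternative \<open>q = 13\<close> is genuine: 13 = 0^2 + 13 * 1^2, while 13 is not in the list
  modulo 52.\<close>

lemma rat_norm_13_iff:
  assumes q: "prime q"
  shows "rat_norm 13 q \<longleftrightarrow> q mod 52 \<in> {1, 9, 17, 25, 29, 49} \<or> q = 13"
proof (cases "q = 13")
  case True
  then show ?thesis by (simp add: rat_norm_self)
next
  case False
  have "\<forall>r\<in>{..<52::nat}. r \<in> {1, 9, 17, 25, 29, 49} \<longleftrightarrow>
      r mod 13 \<in> {1, 3, 4, 9, 10, 12} \<and> r mod 4 = 1"
    by code_simp
  then have "q mod 52 \<in> {1, 9, 17, 25, 29, 49} \<longleftrightarrow>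
      q mod 52 mod 13 \<in> {1, 3, 4, 9, 10, 12} \<and> q mod 52 mod 4 = 1"
    by (rule bspec) simp
  then have mod52: "q mod 52 \<in> {1, 9, 17, 25, 29, 49} \<longleftrightarrow>
      q mod 13 \<in> {1, 3, 4, 9, 10, 12} \<and> q mod 4 = 1"
    by (simp add: mod_mod_cancel)
  show ?thesis
  proof
    assume *: "rat_norm 13 q"
    have "q mod 13 \<in> {1, 3, 4, 9, 10, 12}"
      using QuadRes_if_rat_norm[of 13 q] prime_mod_ne_0[of 13 q] * q False by (auto simp: QuadRes_13)
    moreover from this have "q mod 4 = 1"
      using mod_4_eq_1_if_rat_norm[of 13 q] * q by (cases "q = 2") auto
    ultimately show "q mod 52 \<in> {1, 9, 17, 25, 29, 49} \<or> q = 13"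
      using mod52 by blast
  next
    assume "q mod 52 \<in> {1, 9, 17, 25, 29, 49} \<or> q = 13"
    then have q13: "q mod 13 \<in> {1, 3, 4, 9, 10, 12}" and q4: "q mod 4 = 1"
      using False mod52 by blast+
    then have "2 < q"
      using prime_ge_2_nat[OF q] by (cases "q = 2") auto
    show "rat_norm 13 q"
    proof (rule rat_norm_if_multiples)
      fix k x y assume k: "k \<in> {1..13}" and "QuadRes (int 13) (int (k * q))"
        and eq: "x\<^sup>2 + int 13 * y\<^sup>2 = int (k * q)"
      then have "(k * q) mod 13 \<in> {0, 1, 3, 4, 9, 10, 12}"
        by (simp only: QuadRes_13 of_nat_numeral)
      then have "(k * (q mod 13)) mod 13 \<in> {0, 1, 3, 4, 9, 10, 12}"
        by (simp only: mod_mult_right_eq)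
      moreover have "k \<in> {1, 2, 3, 4, 5, 6, 7, 8, 9, 10, 11, 12, 13}"
        using k unfolding insert_iff empty_iff atLeastAtMost_iff by presburger
      ultimately have k': "k \<in> {1, 3, 4, 9, 10, 12, 13}" using q13 by auto
      have "(x\<^sup>2 mod 16 + 13 * (y\<^sup>2 mod 16)) mod 16 = int (k * q) mod 16"
        using mod_mult_right_eq[of 13 "y\<^sup>2" 16]
          mod_add_cong[of "x\<^sup>2 mod 16" 16 "x\<^sup>2" "13 * (y\<^sup>2 mod 16)" "13 * y\<^sup>2"]
        unfolding eq[symmetric] by simp
      also have "\<dots> = (int k * (int q mod 16)) mod 16"
        by (simp add: mod_simps)
      finally have eq16: "(x\<^sup>2 mod 16 + 13 * (y\<^sup>2 mod 16)) mod 16 = (int k * (int q mod 16)) mod 16" .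
      have q16: "int q mod 16 \<in> {1, 5, 9, 13}"
        using q4 unfolding insert_iff empty_iff by presburger
      \<comment> \<open>Here q = 1 modulo 4. For k = 3, x^2 + y^2 = 3 modulo 4 is impossible. For k
        = 10, x and y are odd, so x^2 + 13 y^2 = 6 modulo 8, while 10 q = 2. For k = 12, x and y are
        even, so x^2 + 13 y^2 is 0, 4 or 8 modulo 16, while 12 q = 12; modulo 8 this would not
        show.\<close>
      have ne16: "\<forall>X\<in>{0, 1, 4, 9 :: int}. \<forall>Y\<in>{0, 1, 4, 9}. \<forall>r\<in>{1, 5, 9, 13}. \<forall>k\<in>{3, 10, 12}.
          (X + 13 * Y) mod 16 \<noteq> (k * r) mod 16"
        by code_simp
      have "int k \<notin> {3, 10, 12}"
        using ne16[THEN bspec, OF square_mod_16[of x], THEN bspec, OF square_mod_16[of y],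
            THEN bspec, OF q16] eq16 by blast
      then have "k = 1 \<or> k = 4 \<or> k = 9 \<or> k = 13" using k' by auto
      then show "rat_norm 13 k"
        using rat_normI[of 1 1 13 0] rat_normI[of 4 2 13 0] rat_normI[of 9 3 13 0]
          rat_norm_self[of 13] by auto
    qed (use q q4 q13 False \<open>2 < q\<close> in \<open>auto simp: QuadRes_13\<close>)
  qed
qed

theorem proposition2p5:
  fixes q :: nat
  assumes "prime q"
  shows "(split_algebra (quaternion_algebra (- 3 :: rat) (of_nat q)) \<longleftrightarrow>
            q mod 3 = 1 \<or> q = 3) \<and>
         (split_algebra (quaternion_algebra (- 5 :: rat) (of_nat q)) \<longleftrightarrow>
            q mod 20 \<in> {1, 9} \<or> q = 5) \<and>
         (split_algebra (quaternion_algebra (- 7 :: rat) (of_nat q)) \<longleftrightarrow>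
            q mod 7 \<in> {1, 2, 4} \<or> q = 7) \<and>
         (split_algebra (quaternion_algebra (- 13 :: rat) (of_nat q)) \<longleftrightarrow>
            q mod 52 \<in> {1, 9, 17, 25, 29, 49} \<or> q = 13)"
  using assms split_iff_rat_norm[of 3 q] split_iff_rat_norm[of 5 q]
    split_iff_rat_norm[of 7 q] split_iff_rat_norm[of 13 q]
  by (simp add: prime_gt_0_nat rat_norm_3_iff rat_norm_5_iff rat_norm_7_iff rat_norm_13_iff)

end
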